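(* For any triangle-free graph $G$ with $\Delta(G)\geq\frac25$, we have $\beta(G)\leq\frac1{50}$.
   Context: All graphs are finite and simple. For a graph $G$ with $n\geq 1$ vertices, $\Delta(G)=\max\{|N_G(v)|/n : v\in V(G)\}$ is the relative (normalized by $n$) maximum degree, where $N_G(v)$ is the set of neighbours of $v$. A half in $G$ is a function $\mu: V(G)\to[0,1]$ such that $\sum_{v\in V(G)}\mu(v)=n/2$. Put $\beta(G,\mu)=\frac1{n^2}\sum_{\{u,v\}\in E(G)}\mu(u)\mu(v)$ (each edge is counted once) and $\beta(G)=\min\{\beta(G,\mu): \mu \text{ is a half in } G\}$. *)

theory Defs
  imports "HOL-Analysis.Analysis"
begin

definition simple_graph :: "'a set \<Rightarrow> 'a set set \<Rightarrow> bool" where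
  "simple_graph V E \<longleftrightarrow> finite V \<and> (\<forall>e\<in>E. e \<subseteq> V \<and> card e = 2)"

definition neighbours :: "'a set \<Rightarrow> 'a set set \<Rightarrow> 'a \<Rightarrow> 'a set" where
  "neighbours V E v = {u \<in> V. {u, v} \<in> E}"

definition triangle_free :: "'a set set \<Rightarrow> bool" where
  "triangle_free E \<longleftrightarrow>
     \<not> (\<exists>u v w. u \<noteq> v \<and> v \<noteq> w \<and> u \<noteq> w \<and> {u, v} \<in> E \<and> {v, w} \<in> E \<and> {u, w} \<in> E)"

definition rel_max_degree :: "'a set \<Rightarrow> 'a set set \<Rightarrow> real" where
  "rel_max_degree V E = Max ((\<lambda>v. real (card (neighbours V E v)) / real (card V)) ` V)"

(* The values of \<mu> outside V are unconstrained; nothing below depends on them. *)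
definition is_half :: "'a set \<Rightarrow> ('a \<Rightarrow> real) \<Rightarrow> bool" where
  "is_half V \<mu> \<longleftrightarrow> \<mu> ` V \<subseteq> {0..1} \<and> (\<Sum>v\<in>V. \<mu> v) = real (card V) / 2"

(* An edge is a two-element set, so the product has exactly the two factors \<mu> u and \<mu> v. *)
definition beta_of :: "'a set \<Rightarrow> 'a set set \<Rightarrow> ('a \<Rightarrow> real) \<Rightarrow> real" where
  "beta_of V E \<mu> = (1 / (real (card V))\<^sup>2) * (\<Sum>e\<in>E. \<Prod>v\<in>e. \<mu> v)"

(* Min is meaningful only for finite sets, hence Inf; the infimum is attained, see beta_attained. *)
definition beta :: "'a set \<Rightarrow> 'a set set \<Rightarrow> real" where
  "beta V E = Inf {beta_of V E \<mu> | \<mu>. is_half V \<mu>}"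

lemma beta_attained:
  fixes V :: "'a set"
  assumes G: "simple_graph V E"
  shows "\<exists>\<mu>. is_half V \<mu> \<and> beta V E = beta_of V E \<mu> \<and>
           (\<forall>\<nu>. is_half V \<nu> \<longrightarrow> beta_of V E \<mu> \<le> beta_of V E \<nu>)"
proof -
  have sub: "e \<subseteq> V" if "e \<in> E" for e
    using G that by (auto simp: simple_graph_def)
  define B where "B = (\<lambda>v. if v \<in> V then {0..1} else {0::real})"
  define K where "K = (\<Pi>\<^sub>E v\<in>UNIV. B v) \<inter> {\<mu>. (\<Sum>v\<in>V. \<mu> v) = real (card V) / 2}"
  have cont1: "continuous_on UNIV (\<lambda>\<mu>::'a \<Rightarrow> real. \<Sum>v\<in>V. \<mu> v)"
    by (intro continuous_intros continuous_on_product_coordinates)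
  have cont2: "continuous_on UNIV (beta_of V E)"
    unfolding beta_of_def
    by (intro continuous_intros continuous_on_product_coordinates)
  have "compact (\<Pi>\<^sub>E v\<in>UNIV. B v)"
    using compactin_PiE[of "\<lambda>_::'a. euclidean :: real topology" UNIV B]
    by (auto simp: B_def euclidean_product_topology)
  moreover have "closed {\<mu>. (\<Sum>v\<in>V. \<mu> v) = real (card V) / 2}"
    using closed_Collect_eq[OF cont1 continuous_on_const] .
  ultimately have "compact K"
    unfolding K_def by (rule compact_Int_closed)
  moreover have "(\<lambda>v. if v \<in> V then 1 / 2 else 0) \<in> K"
    by (auto simp: K_def B_def)
  ultimately obtain \<mu> where mu: "\<mu> \<in> K" "\<forall>\<nu>\<in>K. beta_of V E \<mu> \<le> beta_of V E \<nu>"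
    using continuous_attains_inf[of K "beta_of V E"] continuous_on_subset[OF cont2] by blast
  have half: "is_half V \<mu>"
  proof -
    have "\<mu> v \<in> B v" for v
      using mu(1) by (auto simp: K_def)
    then have "\<mu> v \<in> {0..1}" if "v \<in> V" for v
      using that unfolding B_def by metis
    then show ?thesis
      using mu(1) by (auto simp: K_def is_half_def)
  qed
  have min: "beta_of V E \<mu> \<le> beta_of V E \<nu>" if h: "is_half V \<nu>" for \<nu>
  proof -
    define \<nu>' where "\<nu>' = (\<lambda>v. if v \<in> V then \<nu> v else 0)"
    have "\<nu>' \<in> K"
      using h by (auto simp: K_def B_def is_half_def \<nu>'_def image_subset_iff)
    moreover have "beta_of V E \<nu>' = beta_of V E \<nu>"
      unfolding beta_of_def \<nu>'_def
      using sub by (intro arg_cong2[where f = "(*)"] refl sum.cong prod.cong) auto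
    ultimately show ?thesis
      using mu(2) by force
  qed
  have "beta V E = beta_of V E \<mu>"
    unfolding beta_def by (rule cInf_eq_minimum) (use half min in auto)
  then show ?thesis
    using half min by blast
qed

end

theory Submission
  imports Defs
begin

text \<open>
  Let \<open>A\<close> be the neighbourhood of a vertex of maximum degree \<open>a \<ge> 2/5\<close> (sizes relative to \<open>n\<close>),
  \<open>H\<close> the set of vertices outside \<open>A\<close> with more than \<open>a/2\<close> neighbours in \<open>A\<close>, and \<open>L\<close> the
  remaining vertices. Adjacent vertices have disjoint neighbourhoods, so both \<open>A\<close> and \<open>H\<close> are
  independent, and we may assume that they have sizes \<open>1/2 - s\<close> and \<open>1/2 - t\<close> with \<open>s, t > 0\<close>;
  then \<open>L\<close> has size \<open>s + t\<close>. If some \<open>w \<in> A\<close> has at least \<open>s\<close> neighbours in \<open>L\<close>, then \<open>A\<close> and a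
  fraction of this independent set form a half of weight at most \<open>s a / 2 \<le> 1/50\<close>.
  Otherwise there are at most \<open>a s\<close> edges between \<open>A\<close> and \<open>L\<close>. If neither \<open>A\<close> nor \<open>H\<close>, completed
  to a half by a constant weight on \<open>L\<close>, were good enough, this would contradict the fact that
  the degrees of the vertices in \<open>L\<close> are at most \<open>a\<close>.
\<close>

section \<open>Edge counts as sums of adjacency indicators\<close>

definition adj :: "'a set set \<Rightarrow> 'a \<Rightarrow> 'a \<Rightarrow> real" where
  "adj E u v = of_bool ({u, v} \<in> E)"

text \<open>Edges inside \<open>X \<inter> Y\<close> are counted twice.\<close>

definition edge_count :: "'a set set \<Rightarrow> 'a set \<Rightarrow> 'a set \<Rightarrow> real" where
  "edge_count E X Y = (\<Sum>u\<in>X. \<Sum>v\<in>Y. adj E u v)"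

lemma adj_commute: "adj E u v = adj E v u"
  by (simp add: adj_def insert_commute)

lemma edge_count_commute: "edge_count E X Y = edge_count E Y X"
  unfolding edge_count_def by (subst sum.swap) (simp add: adj_commute)

lemma sum_adj:
  assumes "finite X"
  shows "(\<Sum>v\<in>X. adj E u v) = real (card {v \<in> X. {u, v} \<in> E})"
proof -
  have "(\<Sum>v\<in>X. adj E u v) = (\<Sum>v\<in>{v \<in> X. {u, v} \<in> E}. 1)"
    unfolding adj_def using assms by (intro sum.mono_neutral_cong_right) auto
  then show ?thesis by simp
qed

lemma edge_count_Un:
  assumes "finite X" "finite Y" "X \<inter> Y = {}"
  shows "edge_count E Z (X \<union> Y) = edge_count E Z X + edge_count E Z Y"
  unfolding edge_count_def using assms by (simp add: sum.union_disjoint sum.distrib)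

lemma edge_count_eq_0:
  assumes "\<And>u v. u \<in> X \<Longrightarrow> v \<in> Y \<Longrightarrow> {u, v} \<notin> E"
  shows "edge_count E X Y = 0"
  unfolding edge_count_def adj_def using assms by (intro sum.neutral ballI) simp

text \<open>Each edge \<open>{x, y}\<close> comes from exactly two ordered pairs,
  \<open>(x, y)\<close> and \<open>(y, x)\<close>.\<close>

lemma sum_edges_eq_sum_adj:
  fixes V :: "'a set" and \<mu> :: "'a \<Rightarrow> real"
  assumes G: "simple_graph V E"
  shows "2 * (\<Sum>e\<in>E. \<Prod>v\<in>e. \<mu> v) = (\<Sum>u\<in>V. \<Sum>v\<in>V. \<mu> u * \<mu> v * adj E u v)"
proof -
  have fV: "finite V" and sub: "\<And>e. e \<in> E \<Longrightarrow> e \<subseteq> V" and c2: "\<And>e. e \<in> E \<Longrightarrow> card e = 2"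
    using G by (auto simp: simple_graph_def)
  have fE: "finite E"
    by (rule finite_subset[of _ "Pow V"]) (use sub fV in auto)
  define P where "P = {p \<in> V \<times> V. {fst p, snd p} \<in> E}"
  have fP: "finite P" using fV by (simp add: P_def)
  have "(\<Sum>u\<in>V. \<Sum>v\<in>V. \<mu> u * \<mu> v * adj E u v)
      = (\<Sum>p\<in>V\<times>V. \<mu> (fst p) * \<mu> (snd p) * adj E (fst p) (snd p))"
    by (simp add: sum.cartesian_product case_prod_beta)
  also have "\<dots> = (\<Sum>p\<in>P. \<mu> (fst p) * \<mu> (snd p))"
    unfolding P_def adj_def using fV by (intro sum.mono_neutral_cong_right) auto
  also have "\<dots> = (\<Sum>e\<in>E. \<Sum>p\<in>{p \<in> P. {fst p, snd p} = e}. \<mu> (fst p) * \<mu> (snd p))"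
    by (rule sum.group[OF fP fE, symmetric]) (auto simp: P_def)
  also have "\<dots> = (\<Sum>e\<in>E. 2 * (\<Prod>v\<in>e. \<mu> v))"
  proof (rule sum.cong[OF refl])
    fix e assume e: "e \<in> E"
    then obtain x y where xy: "e = {x, y}" "x \<noteq> y"
      using c2 card_2_iff by metis
    have "{p \<in> P. {fst p, snd p} = e} = {(x, y), (y, x)}"
      using e xy sub[OF e] by (auto simp: P_def doubleton_eq_iff insert_commute)
    then show "(\<Sum>p\<in>{p \<in> P. {fst p, snd p} = e}. \<mu> (fst p) * \<mu> (snd p)) = 2 * (\<Prod>v\<in>e. \<mu> v)"
      using xy by simp
  qed
  finally show ?thesis by (simp add: sum_distrib_left)
qed

section \<open>Upper bounds on \<open>beta\<close> from explicit halves\<close>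

text \<open>The half is 1 on \<open>X\<close>, constantly \<open>c\<close> on \<open>Y\<close> and 0
  elsewhere: \<open>c\<close> spreads the weight missing from \<open>X\<close> evenly, and
  \<open>size\<close> gives \<open>0 \<le> c \<le> 1\<close>. The factor 1/2 undoes the double count
  inside \<open>Y\<close>.\<close>

lemma beta_le:
  assumes G: "simple_graph V E" and "V \<noteq> {}"
    and X: "X \<subseteq> V" "edge_count E X X = 0"
    and Y: "Y \<subseteq> V" "Y \<noteq> {}" "X \<inter> Y = {}"
    and size: "real (card X) \<le> real (card V) / 2" "real (card V) / 2 \<le> real (card X) + real (card Y)"
    and c: "c = (real (card V) / 2 - real (card X)) / real (card Y)"
  shows "beta V E \<le> (c * edge_count E X Y + c\<^sup>2 / 2 * edge_count E Y Y) / (real (card V))\<^sup>2"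
proof -
  have fV: "finite V" using G by (simp add: simple_graph_def)
  have fX: "finite X" and fY: "finite Y" using X(1) Y(1) fV by (auto intro: finite_subset)
  have cY: "real (card Y) > 0" using fY Y by (simp add: card_gt_0_iff)
  define \<mu> where "\<mu> = (\<lambda>v. of_bool (v \<in> X) + c * of_bool (v \<in> Y))"
  have wsum: "(\<Sum>v\<in>V. \<mu> v * f v) = sum f X + c * sum f Y" for f :: "'a \<Rightarrow> real"
  proof -
    have on: "(\<Sum>v\<in>V. of_bool (v \<in> Z) * f v) = sum f Z" if "Z \<subseteq> V" for Z
      using fV that by (intro sum.mono_neutral_cong_right) auto
    have "(\<Sum>v\<in>V. \<mu> v * f v) =
        (\<Sum>v\<in>V. of_bool (v \<in> X) * f v) + c * (\<Sum>v\<in>V. of_bool (v \<in> Y) * f v)"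
      by (simp add: \<mu>_def sum.distrib sum_distrib_left algebra_simps)
    then show ?thesis using on X Y by simp
  qed
  have "0 \<le> c" "c \<le> 1"
    using size cY by (auto simp: c divide_simps)
  then have "\<mu> ` V \<subseteq> {0..1}"
    using Y(3) by (auto simp: \<mu>_def of_bool_def)
  moreover have "(\<Sum>v\<in>V. \<mu> v) = real (card V) / 2"
    using wsum[of "\<lambda>_. 1"] cY by (simp add: c)
  ultimately have half: "is_half V \<mu>"
    by (simp add: is_half_def)
  have "(\<Sum>u\<in>V. \<Sum>v\<in>V. \<mu> u * \<mu> v * adj E u v) = (\<Sum>u\<in>V. \<mu> u * (\<Sum>v\<in>V. \<mu> v * adj E u v))"
    by (simp add: sum_distrib_left mult.assoc)
  also have "\<dots> = edge_count E X X + c * edge_count E X Y + c * (edge_count E Y X + c * edge_count E Y Y)"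
    unfolding wsum edge_count_def by (simp add: sum.distrib sum_distrib_left)
  also have "\<dots> = 2 * (c * edge_count E X Y + c\<^sup>2 / 2 * edge_count E Y Y)"
    using X edge_count_commute[of E Y X] by (simp add: algebra_simps power2_eq_square)
  finally have "(\<Sum>e\<in>E. \<Prod>v\<in>e. \<mu> v) = c * edge_count E X Y + c\<^sup>2 / 2 * edge_count E Y Y"
    using sum_edges_eq_sum_adj[OF G, of \<mu>] by simp
  then have "beta_of V E \<mu> = (c * edge_count E X Y + c\<^sup>2 / 2 * edge_count E Y Y) / (real (card V))\<^sup>2"
    by (simp add: beta_of_def)
  then show ?thesis
    using half beta_attained[OF G] by metis
qed

lemma beta_le_0_if_large_independent:
  assumes G: "simple_graph V E" and V: "V \<noteq> {}"
    and X: "X \<subseteq> V" "edge_count E X X = 0" and size: "real (card V) / 2 \<le> real (card X)"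
  shows "beta V E \<le> 0"
proof -
  have "card V > 0" using G V by (simp add: simple_graph_def card_gt_0_iff)
  then have "X \<noteq> {}" using size by auto
  \<comment> \<open>The empty set plays the role of \<open>X\<close> in \<open>beta_le\<close> and
    the independent set that of \<open>Y\<close>, so both edge counts vanish.\<close>
  from beta_le[OF G V _ _ X(1) this, of "{}"] X(2) size show ?thesis
    by (simp add: edge_count_def)
qed

text \<open>A common neighbour of \<open>x\<close> and \<open>y\<close> would close a triangle, so
  their neighbourhoods in \<open>A\<close> are disjoint.\<close>

lemma adjacent_card_sum_le:
  assumes "triangle_free E" "\<forall>e\<in>E. card e = 2" "finite A" "{x, y} \<in> E"
  shows "card {w \<in> A. {x, w} \<in> E} + card {w \<in> A. {y, w} \<in> E} \<le> card A"
proof -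
  have ne: "u \<noteq> v" if "{u, v} \<in> E" for u v
    using assms(2) that by force
  have "{w \<in> A. {x, w} \<in> E} \<inter> {w \<in> A. {y, w} \<in> E} = {}"
    using assms(1,4) ne unfolding triangle_free_def by blast
  then have "card {w \<in> A. {x, w} \<in> E} + card {w \<in> A. {y, w} \<in> E}
      = card ({w \<in> A. {x, w} \<in> E} \<union> {w \<in> A. {y, w} \<in> E})"
    using assms(3) by (subst card_Un_disjoint) auto
  also have "\<dots> \<le> card A"
    using assms(3) by (intro card_mono) auto
  finally show ?thesis .
qed

section \<open>The numerical contradiction\<close>

text \<open>
  Here \<open>p\<close>, \<open>q\<close>, \<open>r\<close> are the normalized edge counts between \<open>A\<close> and \<open>L\<close>, between \<open>H\<close> and \<open>L\<close>, and
  (counted twice) inside \<open>L\<close>.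
\<close>

lemma half_inequalities_inconsistent:
  fixes s t p q r :: real
  assumes s: "0 < s" "s \<le> 1 / 10" and t: "0 < t"
    and A: "1 / 50 < s / (s + t) * p + (s / (s + t))\<^sup>2 / 2 * r"
    and H: "1 / 50 < t / (s + t) * q + (t / (s + t))\<^sup>2 / 2 * r"
    and deg: "p + q + r \<le> (1 / 2 - s) * (s + t)"
    and p: "p \<le> (1 / 2 - s) * s"
  shows False
proof -
  \<comment> \<open>\<open>P\<close> and \<open>Q\<close> are the normalized average degrees from
    \<open>L\<close> into \<open>A\<close> and into \<open>H\<close>; \<open>e\<close> is the number
    of edges inside \<open>L\<close> divided by the square of its size.\<close>
  define l P Q e where "l = s + t" and "P = p / l" and "Q = q / l" and "e = r / (2 * l\<^sup>2)"
  have l: "l > 0" using s t by (simp add: l_def)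
  have pqr: "p = P * l" "q = Q * l" "r = 2 * e * l\<^sup>2"
    using l by (simp_all add: P_def Q_def e_def)
  have A': "1 / 50 < s * (P + s * e)"
    using A l unfolding l_def[symmetric] pqr by (simp add: field_simps power2_eq_square)
  have H': "1 / 50 < t * (Q + t * e)"
    using H l unfolding l_def[symmetric] pqr by (simp add: field_simps power2_eq_square)
  have "l * (P + Q + 2 * l * e) \<le> l * (1 / 2 - s)"
    using deg unfolding l_def[symmetric] pqr by (simp add: algebra_simps power2_eq_square)
  then have deg': "P + Q + 2 * l * e \<le> 1 / 2 - s"
    using l by simp
  have "1 / 50 / s < P + s * e" "1 / 50 / t < Q + t * e"
    using A' H' s t by (simp_all add: divide_less_eq mult_ac)
  \<comment> \<open>The two lower bounds add up to one on \<open>P + Q + l * e\<close>; subtracting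
    it from \<open>deg'\<close> isolates one copy of \<open>l * e\<close>.\<close>
  then have le: "l * e < 1 / 2 - s - 1 / 50 / s - 1 / 50 / t"
    using deg' by (simp add: l_def algebra_simps)
  \<comment> \<open>Multiplying \<open>A'\<close> by \<open>l\<close> makes the bounds on
    \<open>p = P * l\<close> and on \<open>l * e\<close> applicable, which leaves only
    \<open>s\<close> and \<open>t\<close>.\<close>
  have "1 / 50 * l < s * (P * l + s * (l * e))"
    using mult_strict_right_mono[OF A' l] by (simp add: algebra_simps)
  also have "\<dots> \<le> s * ((1 / 2 - s) * s + s * (l * e))"
    using p s pqr by (intro mult_left_mono) auto
  also have "\<dots> \<le> s * ((1 / 2 - s) * s + s * (1 / 2 - s - 1 / 50 / s - 1 / 50 / t))"
    using le s by (intro mult_left_mono add_mono) auto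
  also have "\<dots> = s\<^sup>2 * (1 - 2 * s) - 1 / 50 * s - 1 / 50 * (s\<^sup>2 / t)"
    using s t by (simp add: field_simps power2_eq_square)
  finally have "1 / 50 * (t + s\<^sup>2 / t) < s * (s * (1 - 2 * s) - 1 / 25)"
    by (simp add: l_def algebra_simps power2_eq_square add_divide_distrib)
  \<comment> \<open>AM-GM eliminates \<open>t\<close>, with equality at
    \<open>t = s\<close>.\<close>
  moreover have "2 * s \<le> t + s\<^sup>2 / t"
    using t sum_squares_ge_zero[of "s - t" 0] by (simp add: field_simps power2_eq_square)
  then have "s * (1 / 25) \<le> 1 / 50 * (t + s\<^sup>2 / t)"
    by simp
  ultimately have "s * (1 / 25) < s * (s * (1 - 2 * s) - 1 / 25)"
    by (rule le_less_trans[rotated])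
  then have "2 / 25 < s * (1 - 2 * s)"
    using s by simp
  \<comment> \<open>On \<open>s \<le> 1 / 10\<close> the value of \<open>s * (1 - 2 * s)\<close> is
    at most 2/25, attained at the endpoint.\<close>
  moreover have "0 \<le> (1 / 10 - s) * (4 / 5 - 2 * s)"
    using s by (intro mult_nonneg_nonneg) auto
  moreover have "(1 / 10 - s) * (4 / 5 - 2 * s) = 2 / 25 - s * (1 - 2 * s)"
    by (simp add: field_simps)
  ultimately show False
    by linarith
qed

section \<open>The graph argument\<close>

theorem mainTheorem10:
  fixes V :: "'a set" and E :: "'a set set"
  assumes "simple_graph V E"
    and "V \<noteq> {}"
    and "triangle_free E"
    and "rel_max_degree V E \<ge> 2 / 5"
  shows "beta V E \<le> 1 / 50"
proof (rule ccontr)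
  assume "\<not> beta V E \<le> 1 / 50"
  then have big: "1 / 50 < beta V E" by simp
  note G = assms(1) and V = assms(2) and tri = assms(3)
  have fV: "finite V" and c2: "\<forall>e\<in>E. card e = 2"
    using G by (auto simp: simple_graph_def)
  define n where "n = real (card V)"
  have n: "n > 0" using fV V by (simp add: n_def card_gt_0_iff)
  have ne: "u \<noteq> v" if "{u, v} \<in> E" for u v
    using c2 that by force
  have no_triangle: False if "{u, v} \<in> E" "{v, w} \<in> E" "{u, w} \<in> E" for u v w
    using tri that ne unfolding triangle_free_def by blast
  obtain v0 where v0: "v0 \<in> V" "rel_max_degree V E = real (card (neighbours V E v0)) / n"
  proof -
    have "rel_max_degree V E \<in> (\<lambda>v. real (card (neighbours V E v)) / n) ` V"
      unfolding rel_max_degree_def n_def using fV V by (intro Max_in) auto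
    then show ?thesis using that by blast
  qed
  define A where "A = neighbours V E v0"
  define a where "a = real (card A)"
  have "2 / 5 \<le> a / n"
    using assms(4) v0 by (simp add: a_def A_def)
  then have a: "2 / 5 * n \<le> a"
    using n by (simp add: field_simps)
  have max_deg: "real (card {v \<in> V. {u, v} \<in> E}) \<le> a" if "u \<in> V" for u
  proof -
    have "real (card (neighbours V E u)) / n \<le> rel_max_degree V E"
      unfolding rel_max_degree_def n_def using fV that by (intro Max_ge) auto
    then have "real (card (neighbours V E u)) \<le> a"
      using n v0 by (simp add: a_def A_def divide_le_cancel)
    then show ?thesis
      by (simp add: neighbours_def insert_commute)
  qed
  define d where "d = (\<lambda>u. real (card {w \<in> A. {u, w} \<in> E}))"
  define H where "H = {u \<in> V - A. d u > a / 2}"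
  define L where "L = {u \<in> V - A. d u \<le> a / 2}"
  define h where "h = real (card H)"
  define l where "l = real (card L)"
  have sub: "A \<subseteq> V" "H \<subseteq> V" "L \<subseteq> V"
    by (auto simp: A_def neighbours_def H_def L_def)
  have fin: "finite A" "finite H" "finite L"
    using sub fV by (auto intro: finite_subset)
  have disj: "A \<inter> H = {}" "A \<inter> L = {}" "H \<inter> L = {}" "(A \<union> H) \<inter> L = {}"
    by (auto simp: H_def L_def)
  have Vun: "V = (A \<union> H) \<union> L"
    using sub by (auto simp: H_def L_def)
  have n_eq: "n = a + h + l"
    unfolding n_def a_def h_def l_def by (subst Vun) (use fin disj in \<open>simp add: card_Un_disjoint\<close>)
  \<comment> \<open>Two adjacent members of \<open>A\<close> would form a triangle with
    \<open>v0\<close>.\<close>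
  have indA: "edge_count E A A = 0"
    by (rule edge_count_eq_0) (use no_triangle in \<open>auto simp: A_def neighbours_def insert_commute\<close>)
  have indH: "edge_count E H H = 0"
  proof (rule edge_count_eq_0, rule notI)
    fix x y assume xy: "x \<in> H" "y \<in> H" "{x, y} \<in> E"
    have "d x + d y \<le> a"
      using adjacent_card_sum_le[OF tri c2 fin(1) xy(3)] unfolding d_def a_def by linarith
    then show False using xy by (simp add: H_def)
  qed
  have small: "a < n / 2" "h < n / 2"
    using beta_le_0_if_large_independent[OF G V sub(1) indA]
      beta_le_0_if_large_independent[OF G V sub(2) indH] big
    unfolding a_def h_def n_def by linarith+
  define s where "s = 1 / 2 - a / n"
  define t where "t = 1 / 2 - h / n"
  \<comment> \<open>The degree hypothesis enters here as \<open>s \<le> 1 / 10\<close>.\<close>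
  have s: "0 < s" "s \<le> 1 / 10" and t: "0 < t"
    using small a n by (simp_all add: s_def t_def field_simps)
  have an: "a = (1 / 2 - s) * n" and hn: "h = (1 / 2 - t) * n"
    using n by (simp_all add: s_def t_def)
  have ln: "l = (s + t) * n"
    using n_eq an hn by (simp add: algebra_simps)
  have l: "l > 0" using s t n by (simp add: ln)
  have "L \<noteq> {}" using l by (auto simp: l_def)
  define p where "p = edge_count E A L / n\<^sup>2"
  define q where "q = edge_count E H L / n\<^sup>2"
  define r where "r = edge_count E L L / n\<^sup>2"
  \<comment> \<open>The weights missing from \<open>A\<close> and from \<open>H\<close>, spread
    evenly over the \<open>(s + t) * n\<close> vertices of \<open>L\<close>, give the constants
    \<open>s / (s + t)\<close> and \<open>t / (s + t)\<close>.\<close>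
  have "n / 2 - a = s * n" "n / 2 - h = t * n"
    by (simp_all add: an hn algebra_simps)
  then have c: "(n / 2 - a) / l = s / (s + t)" "(n / 2 - h) / l = t / (s + t)"
    using n by (simp_all add: ln)
  have "1 / 50 < s / (s + t) * p + (s / (s + t))\<^sup>2 / 2 * r"
  proof -
    have "a \<le> n / 2" "n / 2 \<le> a + l"
      using small n_eq by linarith+
    then have "beta V E \<le> (s / (s + t) * edge_count E A L
        + (s / (s + t))\<^sup>2 / 2 * edge_count E L L) / n\<^sup>2"
      using beta_le[OF G V sub(1) indA sub(3) \<open>L \<noteq> {}\<close> disj(2) _ _ refl]
      unfolding n_def[symmetric] a_def[symmetric] l_def[symmetric] c by blast
    then show ?thesis
      using big unfolding p_def r_def
      by (simp only: add_divide_distrib times_divide_eq_right)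
  qed
  moreover have "1 / 50 < t / (s + t) * q + (t / (s + t))\<^sup>2 / 2 * r"
  proof -
    have "h \<le> n / 2" "n / 2 \<le> h + l"
      using small n_eq by linarith+
    then have "beta V E \<le> (t / (s + t) * edge_count E H L
        + (t / (s + t))\<^sup>2 / 2 * edge_count E L L) / n\<^sup>2"
      using beta_le[OF G V sub(2) indH sub(3) \<open>L \<noteq> {}\<close> disj(3) _ _ refl]
      unfolding n_def[symmetric] h_def[symmetric] l_def[symmetric] c by blast
    then show ?thesis
      using big unfolding q_def r_def
      by (simp only: add_divide_distrib times_divide_eq_right)
  qed
  moreover have "p + q + r \<le> (1 / 2 - s) * (s + t)"
  proof -
    \<comment> \<open>The degrees over \<open>L\<close> are summed, each being at most
      \<open>a\<close>; edges inside \<open>L\<close> contribute twice, as they do in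
      \<open>r\<close>.\<close>
    have "edge_count E L V = edge_count E L A + edge_count E L H + edge_count E L L"
      by (subst Vun) (use fin disj in \<open>simp add: edge_count_Un\<close>)
    moreover have "edge_count E L V \<le> (\<Sum>u\<in>L. a)"
      unfolding edge_count_def sum_adj[OF fV] using max_deg sub by (intro sum_mono) auto
    ultimately have "edge_count E A L + edge_count E H L + edge_count E L L \<le> a * l"
      by (simp add: edge_count_commute[of E L A] edge_count_commute[of E L H] l_def mult.commute)
    then have "p + q + r \<le> a * l / n\<^sup>2"
      unfolding p_def q_def r_def by (simp add: divide_right_mono flip: add_divide_distrib)
    also have "\<dots> = (1 / 2 - s) * (s + t)"
      using n by (simp add: an ln power2_eq_square)
    finally show ?thesis .
  qed
  moreover have "p \<le> (1 / 2 - s) * s"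
  proof -
    \<comment> \<open>Otherwise \<open>Y\<close> has more than \<open>s * n\<close> vertices and can
      carry the weight missing from \<open>A\<close>. It is independent because all its members are
      adjacent to \<open>w\<close>, and each has at most \<open>a / 2\<close> neighbours in
      \<open>A\<close> because \<open>Y\<close> lies in \<open>L\<close>.\<close>
    have few: "real (card {v \<in> L. {w, v} \<in> E}) \<le> s * n" if w: "w \<in> A" for w
    proof (rule ccontr)
      define Y where "Y = {v \<in> L. {w, v} \<in> E}"
      define y where "y = real (card Y)"
      assume "\<not> real (card {v \<in> L. {w, v} \<in> E}) \<le> s * n"
      then have y: "s * n < y" by (simp add: y_def Y_def)
      then have "y > 0" using s n by (meson less_trans mult_pos_pos)
      then have "Y \<noteq> {}" by (auto simp: y_def)
      have Y: "Y \<subseteq> V" "A \<inter> Y = {}" using sub disj by (auto simp: Y_def)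
      have indY: "edge_count E Y Y = 0"
        by (rule edge_count_eq_0) (use no_triangle in \<open>auto simp: Y_def\<close>)
      have "edge_count E A Y = (\<Sum>u\<in>Y. d u)"
        unfolding edge_count_commute[of E A Y] using fin
        by (simp add: edge_count_def sum_adj d_def)
      also have "\<dots> \<le> (\<Sum>u\<in>Y. a / 2)"
        by (rule sum_mono) (auto simp: Y_def L_def)
      finally have dY: "edge_count E A Y \<le> a / 2 * y"
        by (simp add: y_def mult.commute)
      have sn: "n / 2 - a = s * n" by (simp add: an algebra_simps)
      have "beta V E \<le> s * n / y * edge_count E A Y / n\<^sup>2"
        using beta_le[OF G V sub(1) indA Y(1) \<open>Y \<noteq> {}\<close> Y(2) _ _ refl] small y sn
        unfolding n_def[symmetric] a_def[symmetric] y_def[symmetric] indY by simp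
      also have "\<dots> \<le> s * n / y * (a / 2 * y) / n\<^sup>2"
        using dY s n \<open>y > 0\<close> by (intro divide_right_mono mult_left_mono) auto
      also have "\<dots> = s * (1 / 2 - s) / 2"
        using n \<open>y > 0\<close> by (simp add: an power2_eq_square)
      \<comment> \<open>The product \<open>(1 / 10 - s) * (2 / 5 - s)\<close> is
        \<open>1 / 25 - s * (1 / 2 - s)\<close>; equality holds at
        \<open>s = 1 / 10\<close>.\<close>
      also have "\<dots> \<le> 1 / 50"
        using mult_nonneg_nonneg[of "1 / 10 - s" "2 / 5 - s"] s by (simp add: algebra_simps)
      finally show False using big by simp
    qed
    have "edge_count E A L \<le> (\<Sum>u\<in>A. s * n)"
      unfolding edge_count_def sum_adj[OF fin(3)] using few by (intro sum_mono) auto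
    then have "p \<le> a * (s * n) / n\<^sup>2"
      unfolding p_def by (intro divide_right_mono) (auto simp: a_def)
    also have "\<dots> = (1 / 2 - s) * s"
      using n by (simp add: an power2_eq_square)
    finally show ?thesis .
  qed
  ultimately show False
    using half_inequalities_inconsistent[OF s t] by blast
qed

end
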